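(* For every prime $p > 2.67\times 10^{32}$, the least primitive root $g(p)$ modulo $p$ satisfies $g(p) < p^{0.6309}$.
   Context: For a prime $p$, $g(p)$ denotes the least positive integer that is a primitive root modulo $p$, i.e. a generator of the multiplicative group $(\mathbb{Z}/p\mathbb{Z})^\times$. *)

theory Defs
  imports "HOL-Number_Theory.Number_Theory" Complex_Main
begin

definition least_primroot :: "nat \<Rightarrow> nat" where
  "least_primroot n = (LEAST g. g > 0 \<and> residue_primroot n g)"

end

theory Submission
  imports Defs "HOL-Analysis.Convex" "HOL-Library.Real_Mod"
begin

text \<open>
  For a nontrivial character \<open>\<chi>\<close> modulo \<open>p\<close>, the second moment of \<open>\<Sum>n\<in>N. \<chi> (x + n)\<close> over all \<open>x\<close>
  is at most \<open>p |N|\<close>, so by Cauchy--Schwarz \<open>\<Sum>m\<in>M. \<Sum>n\<in>N. \<chi> (m + n)\<close> is at most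
  \<open>sqrt (p |M| |N|)\<close>; averaging over sums \<open>m + n\<close> avoids the logarithm of Polya--Vinogradov.

  An \<open>x\<close> with discrete logarithm \<open>t\<close> is a primitive root iff no prime \<open>q\<close> dividing \<open>p - 1\<close>
  divides \<open>t\<close>. Split these primes into a core \<open>E\<close> of the \<open>k\<close> smallest ones and the remaining set
  \<open>S\<close>, and put \<open>\<delta> = 1 - (\<Sum>q\<in>S. 1 / q)\<close>. The function
  \<open>(\<Prod>q\<in>E. 1 - [q dvd t]) * (1 - (\<Sum>q\<in>S. [q dvd t]))\<close> is positive only at primitive roots.
  Its Fourier expansion has constant term \<open>\<delta> * \<Theta>\<close> with \<open>\<Theta> = (\<Prod>q\<in>E. 1 - 1 / q)\<close> and
  other coefficients of total size at most \<open>\<Theta> * 2 ^ k * (\<delta> + |S|)\<close>. Hence there is a primitive root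
  below \<open>2 A\<close> as soon as \<open>A > sqrt p * 2 ^ k * (1 + |S| / \<delta>)\<close>.

  As the i-th smallest prime (from i = 0) is at least \<open>2 i + 1\<close> for i > 0, taking about a quarter of
  the primes as core keeps \<open>\<delta>\<close> above \<open>0.247\<close>, and then \<open>2 A\<close> stays below
  \<open>p powr (5 / 8)\<close>, up to rounding.
\<close>

section \<open>Invariance of sums over a complete residue system\<close>

lemma sum_residues_shift:
  fixes F :: "nat \<Rightarrow> 'a :: comm_monoid_add"
  assumes "p > 0" and per: "\<And>x y. [x = y] (mod p) \<Longrightarrow> F x = F y"
  shows "(\<Sum>x<p. F (x + h)) = (\<Sum>x<p. F x)"
proof -
  have inj: "inj_on (\<lambda>x. (x + h) mod p) {..<p}"
  proof (rule inj_onI)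
    fix x y assume "x \<in> {..<p}" "y \<in> {..<p}" "(x + h) mod p = (y + h) mod p"
    then have "[x + h = y + h] (mod p)" by (simp add: cong_def)
    then have "[x = y] (mod p)" by (simp add: cong_add_rcancel_nat)
    then show "x = y" using \<open>x \<in> _\<close> \<open>y \<in> _\<close> by (simp add: cong_def)
  qed
  then have img: "(\<lambda>x. (x + h) mod p) ` {..<p} = {..<p}"
    using assms(1) by (intro card_subset_eq) (auto simp: card_image)
  have "(\<Sum>x<p. F x) = (\<Sum>x<p. F ((x + h) mod p))"
    using sum.reindex[OF inj, of F] by (simp add: img)
  also have "\<dots> = (\<Sum>x<p. F (x + h))"
    by (intro sum.cong refl per) (simp add: cong_def)
  finally show ?thesis by simp
qed

lemma sum_residues_scale:
  fixes F :: "nat \<Rightarrow> 'a :: comm_monoid_add"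
  assumes "p > 0" and per: "\<And>x y. [x = y] (mod p) \<Longrightarrow> F x = F y" and "coprime c p"
  shows "(\<Sum>x<p. F (c * x)) = (\<Sum>x<p. F x)"
proof -
  have inj: "inj_on (\<lambda>x. (c * x) mod p) {..<p}"
  proof (rule inj_onI)
    fix x y assume "x \<in> {..<p}" "y \<in> {..<p}" "(c * x) mod p = (c * y) mod p"
    then have "[c * x = c * y] (mod p)" by (simp add: cong_def)
    then have "[x = y] (mod p)" using assms(3) by (simp add: cong_mult_lcancel_nat)
    then show "x = y" using \<open>x \<in> _\<close> \<open>y \<in> _\<close> by (simp add: cong_def)
  qed
  then have img: "(\<lambda>x. (c * x) mod p) ` {..<p} = {..<p}"
    using assms(1) by (intro card_subset_eq) (auto simp: card_image)
  have "(\<Sum>x<p. F x) = (\<Sum>x<p. F ((c * x) mod p))"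
    using sum.reindex[OF inj, of F] by (simp add: img)
  also have "\<dots> = (\<Sum>x<p. F (c * x))"
    by (intro sum.cong refl per) (simp add: cong_def)
  finally show ?thesis by simp
qed

section \<open>Bilinear character sums\<close>

locale nontrivial_character =
  fixes p :: nat and \<chi> :: "nat \<Rightarrow> complex"
  assumes prime: "prime p"
    and periodic: "[x = y] (mod p) \<Longrightarrow> \<chi> x = \<chi> y"
    and mult: "\<chi> (x * y) = \<chi> x * \<chi> y"
    and zero: "p dvd x \<Longrightarrow> \<chi> x = 0"
    and norm_eq_1: "\<not> p dvd x \<Longrightarrow> norm (\<chi> x) = 1"
    and nontrivial: "\<exists>c. \<not> p dvd c \<and> \<chi> c \<noteq> 1"
begin

lemma p_pos: "p > 0"
  using prime by (simp add: prime_gt_0_nat)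

lemma coprime_p: "\<not> p dvd c \<Longrightarrow> coprime c p"
  using prime prime_imp_coprime_nat coprime_commute by blast

lemma periodic_shift: "[x = y] (mod p) \<Longrightarrow> \<chi> (x + a) = \<chi> (y + a)"
  by (intro periodic cong_add) auto

text \<open>Scaling by a unit \<open>c\<close> with \<open>\<chi> c \<noteq> 1\<close> permutes the
  residues, yet multiplies the sum by \<open>\<chi> c\<close>.\<close>

lemma sum_eq_0: "(\<Sum>x<p. \<chi> x) = 0"
proof -
  obtain c where c: "\<not> p dvd c" "\<chi> c \<noteq> 1" using nontrivial by blast
  have "(\<Sum>x<p. \<chi> x) = (\<Sum>x<p. \<chi> (c * x))"
    using sum_residues_scale[of p \<chi> c] p_pos periodic coprime_p c(1) by simp
  also have "\<dots> = \<chi> c * (\<Sum>x<p. \<chi> x)"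
    by (simp add: mult sum_distrib_left)
  finally show ?thesis using c(2) by simp
qed

lemma mult_cnj: "\<chi> x * cnj (\<chi> x) = (if p dvd x then 0 else 1)"
  using norm_eq_1[of x] zero[of x] by (auto simp: complex_norm_square[symmetric])

lemma sum_norm_square: "(\<Sum>x<p. \<chi> x * cnj (\<chi> x)) = of_nat p - 1"
proof -
  have "(\<Sum>x<p. \<chi> x * cnj (\<chi> x)) = (\<Sum>x<p. 1 - (if x = 0 then 1 else 0))"
    by (intro sum.cong) (auto simp: mult_cnj dest: dvd_imp_le)
  also have "\<dots> = of_nat p - 1"
    using p_pos by (simp add: sum_subtractf)
  finally show ?thesis .
qed

text \<open>The autocorrelation is unchanged when the shift is multiplied by a unit, so it is constant
  on nonzero shifts; its sum over all shifts vanishes.\<close>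
lemma autocorrelation:
  assumes "\<not> p dvd h"
  shows "(\<Sum>x<p. \<chi> (x + h) * cnj (\<chi> x)) = -1"
proof -
  define T where "T = (\<lambda>h. \<Sum>x<p. \<chi> (x + h) * cnj (\<chi> x))"
  have T_unit: "T c = T 1" if "\<not> p dvd c" for c
  proof -
    have "T c = (\<Sum>x<p. \<chi> (c * x + c) * cnj (\<chi> (c * x)))"
      unfolding T_def using p_pos coprime_p[OF that]
      by (intro sum_residues_scale[symmetric, where F = "\<lambda>x. \<chi> (x + c) * cnj (\<chi> x)"])
         (auto simp: periodic_shift periodic)
    also have "\<dots> = (\<Sum>x<p. (\<chi> c * cnj (\<chi> c)) * (\<chi> (x + 1) * cnj (\<chi> x)))"
    proof (intro sum.cong refl)
      fix x
      have "c * x + c = c * (x + 1)" by simp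
      then show "\<chi> (c * x + c) * cnj (\<chi> (c * x)) = (\<chi> c * cnj (\<chi> c)) * (\<chi> (x + 1) * cnj (\<chi> x))"
        by (simp only: mult complex_cnj_mult ac_simps)
    qed
    also have "\<dots> = T 1" using that by (simp add: mult_cnj T_def)
    finally show ?thesis .
  qed
  have "(\<Sum>h<p. T h) = (\<Sum>x<p. cnj (\<chi> x) * (\<Sum>h<p. \<chi> (h + x)))"
    unfolding T_def by (subst sum.swap) (simp add: sum_distrib_left ac_simps)
  also have "\<dots> = 0"
    using sum_residues_shift[OF p_pos, of \<chi>] periodic sum_eq_0 by simp
  finally have "(\<Sum>h<p. T h) = 0" .
  moreover have "(\<Sum>h<p. T h) = T 0 + (\<Sum>h\<in>{..<p} - {0}. T h)"
    using p_pos by (subst sum.remove[of _ 0]) auto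
  moreover have "(\<Sum>h\<in>{..<p} - {0}. T h) = (\<Sum>h\<in>{..<p} - {0}. T 1)"
    by (intro sum.cong refl T_unit) (auto dest: dvd_imp_le)
  moreover have "T 0 = of_nat p - 1" using sum_norm_square by (simp add: T_def)
  ultimately have "(of_nat p - 1) * (1 + T 1) = 0"
    using p_pos by (simp add: algebra_simps of_nat_diff)
  moreover have "of_nat p \<noteq> (1 :: complex)"
    using prime_gt_1_nat[OF prime] by simp
  ultimately have "T 1 = -1" by (simp add: add_eq_0_iff)
  then show ?thesis using T_unit[OF assms] by (simp add: T_def)
qed

lemma correlation:
  assumes "a < p" "b < p"
  shows "(\<Sum>x<p. \<chi> (x + a) * cnj (\<chi> (x + b))) = (if a = b then of_nat p else 0) - 1"
proof -
  \<comment> \<open>A representative of \<open>a - b\<close> modulo \<open>p\<close> that avoids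
    truncated subtraction.\<close>
  define h where "h = a + (p - 1) * b"
  have bh: "b + h = a + p * b"
    using p_pos by (cases p) (auto simp: h_def)
  have "(\<Sum>x<p. \<chi> (x + a) * cnj (\<chi> (x + b))) = (\<Sum>x<p. \<chi> (x + b + h) * cnj (\<chi> (x + b)))"
  proof (intro sum.cong refl arg_cong2[where f = "(*)"] periodic)
    fix x show "[x + a = x + b + h] (mod p)"
      by (simp only: add.assoc bh) (simp add: cong_def flip: add.assoc)
  qed
  also have "\<dots> = (\<Sum>x<p. \<chi> (x + h) * cnj (\<chi> x))"
    using p_pos by (intro sum_residues_shift[where F = "\<lambda>x. \<chi> (x + h) * cnj (\<chi> x)"])
      (auto simp: periodic_shift periodic)
  also have "\<dots> = (if a = b then of_nat p else 0) - 1"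
  proof (cases "a = b")
    case True
    then have "h = p * b" using bh by simp
    then have "\<chi> (x + h) = \<chi> x" for x by (intro periodic) (simp add: cong_def)
    then show ?thesis using True sum_norm_square by simp
  next
    case False
    have "\<not> p dvd h"
    proof
      assume "p dvd h"
      then have "[b + h = b] (mod p)" by (auto simp: cong_def)
      moreover have "[b + h = a] (mod p)" by (simp add: bh cong_def)
      ultimately have "[a = b] (mod p)" using cong_sym cong_trans by blast
      then show False using False assms by (simp add: cong_def)
    qed
    then show ?thesis using autocorrelation False by simp
  qed
  finally show ?thesis .
qed

text \<open>Expanding the square leaves correlations: \<open>p - 1\<close> on the diagonal and
  \<open>-1\<close> off it. The exact value is thus \<open>|N| (p - |N|)\<close>.\<close>

lemma second_moment:
  assumes "N \<subseteq> {..<p}"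
  shows "(\<Sum>x<p. (norm (\<Sum>n\<in>N. \<chi> (x + n)))\<^sup>2) \<le> real p * real (card N)"
proof -
  have fin: "finite N" using assms finite_subset by blast
  have "complex_of_real (\<Sum>x<p. (norm (\<Sum>n\<in>N. \<chi> (x + n)))\<^sup>2)
      = (\<Sum>x<p. (\<Sum>n\<in>N. \<chi> (x + n)) * cnj (\<Sum>n\<in>N. \<chi> (x + n)))"
    by (simp only: complex_norm_square of_real_sum)
  also have "\<dots> = (\<Sum>x<p. \<Sum>a\<in>N. \<Sum>b\<in>N. \<chi> (x + a) * cnj (\<chi> (x + b)))"
    by (simp add: sum_product)
  also have "\<dots> = (\<Sum>a\<in>N. \<Sum>b\<in>N. \<Sum>x<p. \<chi> (x + a) * cnj (\<chi> (x + b)))"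
    by (rule trans[OF sum.swap], rule sum.cong[OF refl], rule sum.swap)
  also have "\<dots> = (\<Sum>a\<in>N. \<Sum>b\<in>N. (if a = b then of_nat p else 0) - 1)"
    using assms by (intro sum.cong refl correlation) auto
  also have "\<dots> = complex_of_real (real (card N) * (real p - real (card N)))"
    using fin by (simp add: sum_subtractf sum.delta' algebra_simps)
  finally have "(\<Sum>x<p. (norm (\<Sum>n\<in>N. \<chi> (x + n)))\<^sup>2) = real (card N) * (real p - real (card N))"
    by (simp only: of_real_eq_iff)
  then show ?thesis by (simp add: right_diff_distrib mult.commute)
qed

lemma bilinear_bound:
  assumes "M \<subseteq> {..<p}" "N \<subseteq> {..<p}"
  shows "norm (\<Sum>m\<in>M. \<Sum>n\<in>N. \<chi> (m + n)) \<le> sqrt (real p * real (card M) * real (card N))"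
proof -
  have "norm (\<Sum>m\<in>M. \<Sum>n\<in>N. \<chi> (m + n)) \<le> (\<Sum>m\<in>M. norm (\<Sum>n\<in>N. \<chi> (m + n)))"
    by (rule norm_sum)
  also have "\<dots> \<le> sqrt ((\<Sum>m\<in>M. (norm (\<Sum>n\<in>N. \<chi> (m + n)))\<^sup>2) * card M)"
    by (intro real_le_rsqrt sum_squared_le_sum_of_squares)
  also have "\<dots> \<le> sqrt ((real p * real (card N)) * card M)"
  proof (intro real_sqrt_le_mono mult_right_mono)
    \<comment> \<open>After Cauchy-Schwarz over \<open>M\<close> the terms are nonnegative, so
      \<open>m\<close> may run over all residues.\<close>
    have "(\<Sum>m\<in>M. (norm (\<Sum>n\<in>N. \<chi> (m + n)))\<^sup>2) \<le> (\<Sum>m<p. (norm (\<Sum>n\<in>N. \<chi> (m + n)))\<^sup>2)"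
      using assms(1) by (intro sum_mono2) auto
    also have "\<dots> \<le> real p * real (card N)" by (rule second_moment[OF assms(2)])
    finally show "(\<Sum>m\<in>M. (norm (\<Sum>n\<in>N. \<chi> (m + n)))\<^sup>2) \<le> real p * real (card N)" .
  qed simp
  finally show ?thesis by (simp add: ac_simps)
qed

end

section \<open>Discrete logarithms and the characters built from them\<close>

lemma cis_2pi_eq_1_iff: "cis (2 * pi * x) = 1 \<longleftrightarrow> x \<in> \<int>"
  by (auto simp: cis_eq_1_iff Ints_def mult.commute)

lemma cis_2pi_cong:
  assumes "[s = t] (mod N)" "real N * \<theta> \<in> \<int>"
  shows "cis (2 * pi * (\<theta> * real s)) = cis (2 * pi * (\<theta> * real t))"
proof -
  have *: "cis (2 * pi * (\<theta> * real t)) = cis (2 * pi * (\<theta> * real (t mod N)))" for t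
  proof -
    have "real t = real N * real (t div N) + real (t mod N)"
      by (metis mult_div_mod_eq of_nat_add of_nat_mult)
    then have "2 * pi * (\<theta> * real t) =
        2 * pi * (real N * \<theta> * real (t div N)) + 2 * pi * (\<theta> * real (t mod N))"
      by (simp add: algebra_simps)
    moreover have "real N * \<theta> * real (t div N) \<in> \<int>"
      using Ints_mult[OF assms(2) Ints_of_nat] by blast
    ultimately show ?thesis by (simp only: cis_mult[symmetric] cis_multiple_2pi mult_1)
  qed
  show ?thesis using *[of s] *[of t] assms(1) by (simp add: cong_def)
qed

text \<open>The congruence fixes \<open>ind x\<close> only modulo \<open>p - 1\<close>. The
  periodicity clause makes the number \<open>ind x\<close> itself depend only on the residue of
  \<open>x\<close>, including at multiples of \<open>p\<close>.\<close>

definition discrete_log :: "nat \<Rightarrow> (nat \<Rightarrow> nat) \<Rightarrow> bool" where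
  "discrete_log p ind \<longleftrightarrow> (\<exists>g. residue_primroot p g \<and>
     (\<forall>x. ind x = ind (x mod p)) \<and> (\<forall>x. \<not> p dvd x \<longrightarrow> [g ^ ind x = x] (mod p)))"

lemma discrete_log_exists:
  assumes "prime p"
  obtains ind where "discrete_log p ind"
proof -
  have p1: "p > 1" using assms prime_gt_1_nat by blast
  obtain g where g: "residue_primroot p g"
    using residue_primroot_iff_Carmichael[of p] Carmichael_prime[OF assms]
      totient_prime[OF assms] p1
    by auto
  have "\<exists>t. [g ^ t = x] (mod p)" if "\<not> p dvd x" for x
  proof -
    have "x mod p \<in> totatives p"
      using that p1 assms by (auto simp: totatives_prime dvd_eq_mod_eq_0)
    then obtain t where "x mod p = g ^ t mod p"
      using residue_primroot_is_generator[OF p1 g] by (auto simp: bij_betw_def image_iff)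
    then show ?thesis by (auto simp: cong_def)
  qed
  then have "\<exists>ind. \<forall>x. \<not> p dvd x \<longrightarrow> [g ^ ind x = x] (mod p)" by metis
  then obtain ind where ind: "\<And>x. \<not> p dvd x \<Longrightarrow> [g ^ ind x = x] (mod p)" by blast
  have "discrete_log p (\<lambda>x. ind (x mod p))"
    unfolding discrete_log_def
  proof (intro exI[of _ g] conjI allI impI g)
    fix x assume "\<not> p dvd x"
    then show "[g ^ ind (x mod p) = x] (mod p)"
      using ind[of "x mod p"] by (simp add: cong_def dvd_mod_iff)
  qed simp
  then show ?thesis by (rule that)
qed

lemma discrete_log_mult:
  assumes "prime p" "discrete_log p ind" "\<not> p dvd x" "\<not> p dvd y"
  shows "[ind (x * y) = ind x + ind y] (mod (p - 1))"
proof -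
  obtain g where g: "residue_primroot p g" and ind: "\<And>x. \<not> p dvd x \<Longrightarrow> [g ^ ind x = x] (mod p)"
    using assms(2) by (auto simp: discrete_log_def)
  have cop: "coprime p g" "ord p g = p - 1"
    using g assms(1) by (auto simp: residue_primroot_def totient_prime)
  have "\<not> p dvd x * y" using assms by (simp add: prime_dvd_mult_iff)
  then have "[g ^ ind (x * y) = x * y] (mod p)" by (rule ind)
  moreover have "[g ^ (ind x + ind y) = x * y] (mod p)"
    unfolding power_add using assms by (intro cong_mult ind)
  ultimately have "[g ^ ind (x * y) = g ^ (ind x + ind y)] (mod p)"
    using cong_sym cong_trans by blast
  then show ?thesis using order_divides_expdiff[OF cop(1)] cop(2) by simp
qed

lemma residue_primroot_if_coprime_discrete_log:
  assumes "prime p" "discrete_log p ind" "\<not> p dvd x" "coprime (ind x) (p - 1)"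
  shows "residue_primroot p x"
proof -
  obtain g where g: "residue_primroot p g" and ind: "[g ^ ind x = x] (mod p)"
    using assms(2,3) by (auto simp: discrete_log_def)
  have cop: "coprime p g" "ord p g = p - 1"
    using g assms(1) by (auto simp: residue_primroot_def totient_prime)
  have "ord p (g ^ ind x) = p - 1"
    using ord_power[OF cop(1), of "ind x"] cop(2) assms(4) by (simp add: coprime_commute)
  then have "residue_primroot p (g ^ ind x)"
    using cop assms(1) by (simp add: residue_primroot_def totient_prime prime_gt_0_nat)
  then show ?thesis using residue_primroot_cong[OF ind] by simp
qed

text \<open>Integrality of \<open>(p - 1) * \<theta>\<close> makes the wave well defined on
  exponents modulo \<open>p - 1\<close>, hence multiplicative. As the primitive root
  \<open>g\<close> has index 1 modulo \<open>p - 1\<close>, its value differs from 1 exactly because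
  \<open>\<theta>\<close> is not an integer.\<close>

lemma nontrivial_character_cis:
  assumes p: "prime p" and ind: "discrete_log p ind"
    and \<theta>: "real (p - 1) * \<theta> \<in> \<int>" "\<theta> \<notin> \<int>"
  shows "nontrivial_character p
    (\<lambda>x. if p dvd x then 0 else cis (2 * pi * (\<theta> * real (ind x))))"
proof
  show "prime p" by fact
next
  fix x y assume "[x = y] (mod p)"
  moreover have "ind x = ind (x mod p)" "ind y = ind (y mod p)"
    using ind by (auto simp: discrete_log_def)
  ultimately have "ind x = ind y" "p dvd x \<longleftrightarrow> p dvd y"
    by (auto simp: cong_def dvd_eq_mod_eq_0)
  then show "(if p dvd x then 0 else cis (2 * pi * (\<theta> * real (ind x)))) =
      (if p dvd y then 0 else cis (2 * pi * (\<theta> * real (ind y))))" by simp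
next
  fix x y
  have "cis (2 * pi * (\<theta> * real (ind (x * y)))) =
      cis (2 * pi * (\<theta> * real (ind x))) * cis (2 * pi * (\<theta> * real (ind y)))"
    if "\<not> p dvd x" "\<not> p dvd y"
    using cis_2pi_cong[OF discrete_log_mult[OF p ind that] \<theta>(1)]
    by (simp add: cis_mult algebra_simps)
  then show "(if p dvd x * y then 0 else cis (2 * pi * (\<theta> * real (ind (x * y))))) =
      (if p dvd x then 0 else cis (2 * pi * (\<theta> * real (ind x)))) *
      (if p dvd y then 0 else cis (2 * pi * (\<theta> * real (ind y))))"
    using p by (auto simp: prime_dvd_mult_iff)
next
  obtain g where g: "residue_primroot p g" and ind': "\<And>x. \<not> p dvd x \<Longrightarrow> [g ^ ind x = x] (mod p)"
    using ind by (auto simp: discrete_log_def)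
  have cop: "coprime p g" "ord p g = p - 1"
    using g p by (auto simp: residue_primroot_def totient_prime)
  have ng: "\<not> p dvd g"
    using cop(1) p by (metis coprime_absorb_left not_prime_unit)
  have "[g ^ ind g = g ^ 1] (mod p)" using ind'[OF ng] by simp
  then have "[ind g = 1] (mod (p - 1))"
    using order_divides_expdiff[OF cop(1), of "ind g" 1] cop(2) by simp
  from cis_2pi_cong[OF this \<theta>(1)] have "cis (2 * pi * (\<theta> * real (ind g))) \<noteq> 1"
    using \<theta>(2) cis_2pi_eq_1_iff[of \<theta>] by simp
  then show "\<exists>c. \<not> p dvd c \<and> (if p dvd c then 0 else cis (2 * pi * (\<theta> * real (ind c)))) \<noteq> 1"
    using ng by auto
qed auto

section \<open>Trigonometric sums without constant term\<close>

text \<open>\<open>oscillating D W F\<close>: \<open>F\<close> is a finite combination of exponentials whose frequencies lie in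
  \<open>\<int> / D\<close> but not in \<open>\<int>\<close>, with coefficients of total absolute value \<open>W\<close>.\<close>
inductive oscillating :: "nat \<Rightarrow> real \<Rightarrow> (nat \<Rightarrow> complex) \<Rightarrow> bool" for D :: nat where
  zero: "oscillating D 0 (\<lambda>_. 0)"
| wave: "real D * \<theta> \<in> \<int> \<Longrightarrow> \<theta> \<notin> \<int> \<Longrightarrow> oscillating D W F \<Longrightarrow>
    oscillating D (norm b + W) (\<lambda>t. b * cis (2 * pi * (\<theta> * real t)) + F t)"

lemma oscillating_add:
  assumes "oscillating D W F" "oscillating D V G"
  shows "oscillating D (W + V) (\<lambda>t. F t + G t)"
  using assms(1)
proof induction
  case (wave \<theta> W F b)
  from oscillating.wave[OF wave.hyps(1,2) wave.IH, of b] show ?case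
    by (simp add: add.assoc)
qed (use assms(2) in simp)

lemma oscillating_single:
  "real D * \<theta> \<in> \<int> \<Longrightarrow> \<theta> \<notin> \<int> \<Longrightarrow>
    oscillating D (norm b) (\<lambda>t. b * cis (2 * pi * (\<theta> * real t)))"
  using oscillating.wave[OF _ _ oscillating.zero, of D \<theta> b] by simp

lemma oscillating_cmult:
  assumes "oscillating D W F"
  shows "oscillating D (norm c * W) (\<lambda>t. c * F t)"
  using assms
proof induction
  case zero
  then show ?case using oscillating.zero by simp
next
  case (wave \<theta> W F b)
  from oscillating.wave[OF wave.hyps(1,2) wave.IH, of "c * b"] show ?case
    by (simp add: norm_mult algebra_simps)
qed

lemma oscillating_sum:
  assumes "finite I" "\<And>i. i \<in> I \<Longrightarrow> oscillating D (W i) (F i)"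
  shows "oscillating D (\<Sum>i\<in>I. W i) (\<lambda>t. \<Sum>i\<in>I. F i t)"
  using assms by (induction I rule: finite_induct) (auto intro: oscillating.zero oscillating_add)

lemma oscillating_dvd:
  assumes "oscillating D W F" "D dvd D'"
  shows "oscillating D' W F"
  using assms(1)
proof induction
  case (wave \<theta> W F b)
  obtain k where "D' = D * k" using assms(2) by blast
  moreover have "real D * \<theta> * real k \<in> \<int>"
    using Ints_mult[OF wave.hyps(1) Ints_of_nat] by blast
  ultimately have "real D' * \<theta> \<in> \<int>" by (simp add: ac_simps)
  then show ?case by (intro oscillating.wave wave.hyps wave.IH)
qed (rule oscillating.zero)

text \<open>Frequencies with coprime denominators cannot cancel, so a product of oscillating functions
  has no constant wave.\<close>
lemma frequency_add_notin_Ints: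
  assumes "coprime D E" "real D * \<theta> \<in> \<int>" "real E * \<eta> \<in> \<int>" "\<theta> \<notin> \<int>"
  shows "\<theta> + \<eta> \<notin> \<int>"
proof
  assume *: "\<theta> + \<eta> \<in> \<int>"
  have "real E * (\<theta> + \<eta>) - real E * \<eta> \<in> \<int>"
    by (intro Ints_diff Ints_mult[OF Ints_of_nat *] assms(3))
  then have E: "real E * \<theta> \<in> \<int>" by (simp add: algebra_simps)
  obtain u v where "u * int D + v * int E = 1"
    using bezout_int[of "int D" "int E"] coprime_imp_gcd_eq_1[of "int D" "int E"] assms(1)
    by fastforce
  then have "real_of_int u * real D + real_of_int v * real E = 1"
    by (metis of_int_1 of_int_add of_int_mult of_int_of_nat_eq)
  then have "\<theta> = real_of_int u * (real D * \<theta>) + real_of_int v * (real E * \<theta>)"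
    by (metis distrib_right mult.assoc mult_1)
  also have "\<dots> \<in> \<int>" by (intro Ints_add Ints_mult[OF Ints_of_int] assms(2) E)
  finally show False using assms(4) by simp
qed

lemma oscillating_mult:
  assumes "coprime D E" "oscillating D W F" "oscillating E V G"
  shows "oscillating (D * E) (W * V) (\<lambda>t. F t * G t)"
  using assms(2)
proof induction
  case zero
  then show ?case using oscillating.zero by simp
next
  case (wave \<theta> W F b)
  \<comment> \<open>The inner induction multiplies one wave of \<open>F\<close> by all of
    \<open>G\<close>: frequencies add and absolute values of coefficients multiply.\<close>
  have "oscillating (D * E) (norm b * V) (\<lambda>t. b * cis (2 * pi * (\<theta> * real t)) * G t)"
    using assms(3)
  proof induction
    case zero
    then show ?case using oscillating.zero by simp
  next
    case (wave \<eta> V G c)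
    have "real E * (real D * \<theta>) + real D * (real E * \<eta>) \<in> \<int>"
      by (intro Ints_add Ints_mult[OF Ints_of_nat] wave.hyps \<open>real D * \<theta> \<in> \<int>\<close>)
    then have "real (D * E) * (\<theta> + \<eta>) \<in> \<int>" by (simp add: algebra_simps)
    moreover have "\<theta> + \<eta> \<notin> \<int>"
      using frequency_add_notin_Ints assms(1) wave.hyps \<open>real D * \<theta> \<in> \<int>\<close> \<open>\<theta> \<notin> \<int>\<close> by blast
    ultimately show ?case
      using oscillating.wave[OF _ _ wave.IH, of "\<theta> + \<eta>" "b * c"]
      by (simp add: norm_mult algebra_simps flip: cis_mult)
  qed
  from oscillating_add[OF this wave.IH] show ?case
    by (simp add: algebra_simps)
qed

text \<open>Since \<open>D\<close> divides \<open>p - 1\<close>, every wave composed with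
  \<open>ind\<close> is a nontrivial character away from multiples of \<open>p\<close>. Thus
  \<open>bilinear_bound\<close> applies wave by wave, and the coefficients add up to
  \<open>W\<close>.\<close>

lemma oscillating_bilinear_bound:
  assumes osc: "oscillating D W F" and "D dvd p - 1"
    and p: "prime p" and ind: "discrete_log p ind"
    and MN: "M \<subseteq> {..<p}" "N \<subseteq> {..<p}" "\<And>m n. m \<in> M \<Longrightarrow> n \<in> N \<Longrightarrow> \<not> p dvd m + n"
  shows "norm (\<Sum>m\<in>M. \<Sum>n\<in>N. F (ind (m + n))) \<le> W * sqrt (real p * real (card M) * real (card N))"
  using oscillating_dvd[OF osc assms(2)]
proof induction
  case (wave \<theta> W F b)
  let ?\<chi> = "\<lambda>x. if p dvd x then 0 else cis (2 * pi * (\<theta> * real (ind x)))"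
  interpret nontrivial_character p ?\<chi>
    by (rule nontrivial_character_cis[OF p ind wave.hyps(1,2)])
  have "(\<Sum>m\<in>M. \<Sum>n\<in>N. b * cis (2 * pi * (\<theta> * real (ind (m + n)))) + F (ind (m + n)))
      = b * (\<Sum>m\<in>M. \<Sum>n\<in>N. ?\<chi> (m + n)) + (\<Sum>m\<in>M. \<Sum>n\<in>N. F (ind (m + n)))"
    using MN(3) by (simp add: sum.distrib sum_distrib_left cong: sum.cong)
  also have "norm \<dots> \<le> norm b * norm (\<Sum>m\<in>M. \<Sum>n\<in>N. ?\<chi> (m + n))
      + norm (\<Sum>m\<in>M. \<Sum>n\<in>N. F (ind (m + n)))"
    by (rule order.trans[OF norm_triangle_ineq]) (simp add: norm_mult)
  also have "\<dots> \<le> norm b * sqrt (real p * real (card M) * real (card N))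
      + W * sqrt (real p * real (card M) * real (card N))"
    by (intro add_mono mult_left_mono bilinear_bound MN wave.IH) auto
  finally show ?case by (simp add: distrib_right)
qed simp

text \<open>A geometric sum whose ratio is a \<open>q\<close>-th root of unity, equal to 1 iff
  \<open>q dvd t\<close>.\<close>

lemma sum_roots_of_unity_dvd:
  assumes "q > 0"
  shows "(\<Sum>j<q. cis (2 * pi * (real j / real q * real t))) = (if q dvd t then of_nat q else 0)"
proof -
  define z where "z = cis (2 * pi * (real t / real q))"
  have "(\<Sum>j<q. cis (2 * pi * (real j / real q * real t))) = (\<Sum>j<q. z ^ j)"
    by (simp add: z_def DeMoivre algebra_simps)
  also have "\<dots> = (if q dvd t then of_nat q else 0)"
  proof (cases "q dvd t")
    case True
    then have "real t / real q \<in> \<int>" by (auto elim!: dvdE)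
    then have "z = 1" by (simp only: z_def cis_2pi_eq_1_iff)
    then show ?thesis using True by simp
  next
    case False
    have "real t / real q \<notin> \<int>"
    proof
      assume "real t / real q \<in> \<int>"
      then obtain k where "real t / real q = of_int k" by (auto elim: Ints_cases)
      then have "real t = of_int k * real q" using assms by (simp add: field_simps)
      then have "int t = k * int q" by (metis of_int_eq_iff of_int_mult of_int_of_nat_eq)
      then have "int q dvd int t" by simp
      then show False using False by simp
    qed
    then have "z \<noteq> 1" by (simp only: z_def cis_2pi_eq_1_iff not_False_eq_True)
    moreover have "z ^ q = cis (2 * pi * real t)"
      using assms by (simp add: z_def DeMoivre)
    then have "z ^ q = 1" by (simp only: cis_2pi_eq_1_iff Ints_of_nat)
    ultimately show ?thesis using False by (simp add: geometric_sum)
  qed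
  finally show ?thesis .
qed

text \<open>In the expansion by roots of unity the term \<open>j = 0\<close> is the constant
  \<open>1 / q\<close>. The other \<open>q - 1\<close> terms have coefficient \<open>1 / q\<close>
  and frequency strictly between 0 and 1.\<close>

lemma oscillating_dvd_indicator:
  assumes "q > 0"
  shows "oscillating q (1 - 1 / real q) (\<lambda>t. (if q dvd t then 1 else 0) - 1 / of_nat q)"
proof -
  define F where "F = (\<lambda>j t. 1 / of_nat q * cis (2 * pi * (real j / real q * real t)))"
  have "oscillating q (\<Sum>j\<in>{..<q} - {0}. norm (1 / of_nat q :: complex))
      (\<lambda>t. \<Sum>j\<in>{..<q} - {0}. F j t)"
    unfolding F_def
  proof (intro oscillating_sum oscillating_single)
    fix j assume j: "j \<in> {..<q} - {0}"
    then show "real q * (real j / real q) \<in> \<int>" using assms by simp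
    from j have "0 < real j / real q" "real j / real q < 1" by auto
    then show "real j / real q \<notin> \<int>"
      by (smt (verit, best) Ints_cases of_int_0_less_iff of_int_less_1_iff)
  qed simp
  moreover have "(\<Sum>j\<in>{..<q} - {0}. norm (1 / of_nat q :: complex)) = 1 - 1 / real q"
    using assms by (simp add: norm_divide field_simps of_nat_diff)
  moreover have "(\<Sum>j\<in>{..<q} - {0}. F j t) = (if q dvd t then 1 else 0) - 1 / of_nat q" for t
  proof -
    have "(\<Sum>j<q. F j t) = F 0 t + (\<Sum>j\<in>{..<q} - {0}. F j t)"
      using assms by (subst sum.remove[of _ 0]) auto
    moreover have "(\<Sum>j<q. F j t) = (if q dvd t then 1 else 0)"
      unfolding F_def sum_distrib_left[symmetric] sum_roots_of_unity_dvd[OF assms]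
      using assms by simp
    ultimately show ?thesis by (simp add: F_def algebra_simps)
  qed
  ultimately show ?thesis by simp
qed

section \<open>The sieve\<close>

text \<open>By induction: a new prime contributes the factor \<open>c - r\<close>, and \<open>(c -
  r) P - c \<Theta> = c (P - \<Theta>) - \<Theta> r - (P - \<Theta>) r\<close>. In units of
  \<open>c \<Theta>\<close> the three weights are \<open>2^k - 1\<close>, \<open>1\<close> and
  \<open>2^k - 1\<close>, where \<open>k = card E\<close>; their sum is
  \<open>2^(k+1) - 1\<close>.\<close>

lemma oscillating_sieve_product:
  assumes "finite E" "\<And>q. q \<in> E \<Longrightarrow> prime q"
  shows "oscillating (\<Prod>E) ((2 ^ card E - 1) * (\<Prod>q\<in>E. 1 - 1 / real q))
    (\<lambda>t. (\<Prod>q\<in>E. 1 - (if q dvd t then 1 else 0)) - of_real (\<Prod>q\<in>E. 1 - 1 / real q))"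
  using assms
proof (induction E rule: finite_induct)
  case empty
  then show ?case using oscillating.zero by simp
next
  case (insert q E)
  define \<Theta> where "\<Theta> = (\<Prod>q\<in>E. 1 - 1 / real q)"
  define P :: "nat \<Rightarrow> complex" where "P = (\<lambda>t. \<Prod>q\<in>E. 1 - (if q dvd t then 1 else 0))"
  define r :: "nat \<Rightarrow> complex" where "r = (\<lambda>t. (if q dvd t then 1 else 0) - 1 / of_nat q)"
  define c where "c = 1 - 1 / real q"
  have q: "q > 0" using insert.prems prime_gt_0_nat by blast
  have c0: "c \<ge> 0" using q by (simp add: c_def)
  have \<Theta>0: "\<Theta> \<ge> 0" unfolding \<Theta>_def using insert.prems
    by (intro prod_nonneg) (auto simp: Suc_le_eq prime_gt_0_nat)
  have cop: "coprime (\<Prod>E) q"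
    using insert by (intro prod_coprime_left) (auto intro!: primes_coprime)
  have IH: "oscillating (\<Prod>E) ((2 ^ card E - 1) * \<Theta>) (\<lambda>t. P t - of_real \<Theta>)"
    using insert by (simp add: \<Theta>_def P_def)
  have r: "oscillating q c r"
    unfolding c_def r_def using oscillating_dvd_indicator[OF q] .
  have 1: "oscillating (\<Prod>E * q) (norm (of_real c :: complex) * ((2 ^ card E - 1) * \<Theta>))
      (\<lambda>t. of_real c * (P t - of_real \<Theta>))"
    by (intro oscillating_cmult oscillating_dvd[OF IH]) simp
  have 2: "oscillating (\<Prod>E * q) (norm (- of_real \<Theta> :: complex) * c) (\<lambda>t. - of_real \<Theta> * r t)"
    by (intro oscillating_cmult oscillating_dvd[OF r]) simp
  have 3: "oscillating (\<Prod>E * q) (norm (-1 :: complex) * (((2 ^ card E - 1) * \<Theta>) * c))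
      (\<lambda>t. - 1 * ((P t - of_real \<Theta>) * r t))"
    by (intro oscillating_cmult oscillating_mult[OF cop IH r])
  have "norm (of_real c :: complex) * ((2 ^ card E - 1) * \<Theta>) + norm (- of_real \<Theta> :: complex) * c
      + norm (-1 :: complex) * (((2 ^ card E - 1) * \<Theta>) * c)
      = (2 ^ card (insert q E) - 1) * (\<Prod>q\<in>insert q E. 1 - 1 / real q)"
    using insert.hyps c0 \<Theta>0 by (simp add: \<Theta>_def[symmetric] c_def[symmetric] algebra_simps)
  moreover have "(\<lambda>t. of_real c * (P t - of_real \<Theta>) + - of_real \<Theta> * r t
        + - 1 * ((P t - of_real \<Theta>) * r t)) =
     (\<lambda>t. (\<Prod>q\<in>insert q E. 1 - (if q dvd t then 1 else 0))
        - of_real (\<Prod>q\<in>insert q E. 1 - 1 / real q))"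
  proof
    fix t
    have "(\<Prod>q\<in>insert q E. 1 - (if q dvd t then 1 else 0)) = (of_real c - r t) * P t"
      using insert.hyps by (simp add: P_def r_def c_def)
    moreover have "(\<Prod>q\<in>insert q E. 1 - 1 / real q) = c * \<Theta>"
      using insert.hyps by (simp add: \<Theta>_def c_def)
    ultimately show "of_real c * (P t - of_real \<Theta>) + - of_real \<Theta> * r t
        + - 1 * ((P t - of_real \<Theta>) * r t) =
      (\<Prod>q\<in>insert q E. 1 - (if q dvd t then 1 else 0)) - of_real (\<Prod>q\<in>insert q E. 1 - 1 / real q)"
      by (simp add: algebra_simps)
  qed
  moreover have "\<Prod>(insert q E) = \<Prod>E * q" using insert.hyps by simp
  ultimately show ?case
    using oscillating_add[OF oscillating_add[OF 1 2] 3] by metis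
qed

text \<open>With \<open>r q\<close> the oscillating part of the indicator of \<open>q\<close>, the
  function minus its mean is \<open>\<delta> (P - \<Theta>) - (\<Sum>q\<in>S. P * r q)\<close>. The
  weight \<open>W\<close> is existential because \<open>oscillating\<close> records an exact total,
  while only an upper bound is wanted.\<close>

lemma oscillating_sieve:
  assumes fin: "finite E" "finite S" and disj: "E \<inter> S = {}"
    and pr: "\<And>q. q \<in> E \<union> S \<Longrightarrow> prime q"
  defines "\<delta> \<equiv> 1 - (\<Sum>q\<in>S. 1 / real q)" and "\<Theta> \<equiv> (\<Prod>q\<in>E. 1 - 1 / real q)"
  assumes \<delta>: "\<delta> \<ge> 0"
  obtains W where "W \<le> \<Theta> * 2 ^ card E * (\<delta> + real (card S))"
    and "oscillating (\<Prod>(E \<union> S)) W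
      (\<lambda>t. (\<Prod>q\<in>E. 1 - (if q dvd t then 1 else 0)) * (1 - (\<Sum>q\<in>S. if q dvd t then 1 else 0))
        - of_real (\<delta> * \<Theta>))"
proof -
  define P :: "nat \<Rightarrow> complex" where "P = (\<lambda>t. \<Prod>q\<in>E. 1 - (if q dvd t then 1 else 0))"
  define r :: "nat \<Rightarrow> nat \<Rightarrow> complex" where "r = (\<lambda>q t. (if q dvd t then 1 else 0) - 1 / of_nat q)"
  have \<Theta>0: "\<Theta> \<ge> 0" unfolding \<Theta>_def using pr
    by (intro prod_nonneg) (auto simp: Suc_le_eq prime_gt_0_nat)
  have P: "oscillating (\<Prod>E) ((2 ^ card E - 1) * \<Theta>) (\<lambda>t. P t - of_real \<Theta>)"
    unfolding P_def \<Theta>_def using fin pr by (intro oscillating_sieve_product) auto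
  have Pr: "oscillating (\<Prod>(E \<union> S)) (2 ^ card E * \<Theta> * (1 - 1 / real q)) (\<lambda>t. P t * r q t)"
    if q: "q \<in> S" for q
  proof -
    have r: "oscillating q (1 - 1 / real q) (r q)"
      unfolding r_def using pr q prime_gt_0_nat by (intro oscillating_dvd_indicator) auto
    have cop: "coprime (\<Prod>E) q"
      using disj pr q by (intro prod_coprime_left) (auto intro!: primes_coprime)
    \<comment> \<open>Splitting \<open>P\<close> into \<open>P - \<Theta>\<close> and
      \<open>\<Theta>\<close> keeps both products free of a constant term; the weights combine as
      \<open>(2^k - 1) + 1 = 2^k\<close> with \<open>k = card E\<close>.\<close>
    have "oscillating (\<Prod>E * q) (((2 ^ card E - 1) * \<Theta>) * (1 - 1 / real q)
          + norm (of_real \<Theta> :: complex) * (1 - 1 / real q))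
       (\<lambda>t. (P t - of_real \<Theta>) * r q t + of_real \<Theta> * r q t)"
      by (intro oscillating_add oscillating_mult[OF cop P r] oscillating_cmult
          oscillating_dvd[OF r]) simp
    also have "((2 ^ card E - 1) * \<Theta>) * (1 - 1 / real q)
          + norm (of_real \<Theta> :: complex) * (1 - 1 / real q)
        = 2 ^ card E * \<Theta> * (1 - 1 / real q)"
      using \<Theta>0 by (simp add: algebra_simps)
    also have "(\<lambda>t. (P t - of_real \<Theta>) * r q t + of_real \<Theta> * r q t) = (\<lambda>t. P t * r q t)"
      by (simp add: algebra_simps)
    finally show ?thesis
    proof (rule oscillating_dvd)
      have "\<Prod>E * q = \<Prod>(insert q E)" using fin disj q by (subst prod.insert) auto
      then show "\<Prod>E * q dvd \<Prod>(E \<union> S)"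
        using fin q by (auto intro!: prod_dvd_prod_subset)
    qed
  qed
  have P': "oscillating (\<Prod>(E \<union> S)) ((2 ^ card E - 1) * \<Theta>) (\<lambda>t. P t - of_real \<Theta>)"
    using fin by (intro oscillating_dvd[OF P] prod_dvd_prod_subset) auto
  define W where "W = norm (of_real \<delta> :: complex) * ((2 ^ card E - 1) * \<Theta>)
      + norm (-1 :: complex) * (\<Sum>q\<in>S. 2 ^ card E * \<Theta> * (1 - 1 / real q))"
  have osc: "oscillating (\<Prod>(E \<union> S)) W
      (\<lambda>t. of_real \<delta> * (P t - of_real \<Theta>) + -1 * (\<Sum>q\<in>S. P t * r q t))"
    unfolding W_def using Pr fin
    by (intro oscillating_add oscillating_cmult P' oscillating_sum) auto
  have "W = \<delta> * (2 ^ card E - 1) * \<Theta> + 2 ^ card E * \<Theta> * (\<Sum>q\<in>S. 1 - 1 / real q)"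
    using \<delta> by (simp add: W_def sum_distrib_left)
  also have "\<dots> \<le> \<delta> * 2 ^ card E * \<Theta> + 2 ^ card E * \<Theta> * real (card S)"
  proof (intro add_mono mult_left_mono mult_right_mono)
    show "(\<Sum>q\<in>S. 1 - 1 / real q) \<le> real (card S)"
      using sum_bounded_above[of S "\<lambda>q. 1 - 1 / real q" 1] by simp
  qed (use \<delta> \<Theta>0 in auto)
  finally have W: "W \<le> \<Theta> * 2 ^ card E * (\<delta> + real (card S))"
    by (simp add: algebra_simps)
  have "(\<Sum>q\<in>S. r q t) = (\<Sum>q\<in>S. if q dvd t then 1 else 0) - (1 - of_real \<delta>)" for t
    by (simp add: \<delta>_def r_def sum_subtractf)
  then have "of_real \<delta> * (P t - of_real \<Theta>) + -1 * (\<Sum>q\<in>S. P t * r q t) =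
      P t * (1 - (\<Sum>q\<in>S. if q dvd t then 1 else 0)) - of_real (\<delta> * \<Theta>)" for t
    by (simp add: sum_distrib_left[symmetric]) (simp add: algebra_simps)
  then show ?thesis using that[OF W] osc unfolding P_def by simp
qed

section \<open>From the sieve to a small primitive root\<close>

lemma prod_primes_dvd:
  fixes n :: nat
  assumes "finite Q" "\<And>q. q \<in> Q \<Longrightarrow> prime q \<and> q dvd n"
  shows "\<Prod>Q dvd n"
  using assms
proof (induction Q rule: finite_induct)
  case (insert q Q)
  have "coprime q (\<Prod>Q)"
    using insert by (intro prod_coprime_right) (auto intro!: primes_coprime)
  then have "q * \<Prod>Q dvd n" using insert by (intro divides_mult) auto
  then show ?case using insert.hyps by simp
qed simp

text \<open>Without such a root the sieve function \<open>f\<close> is nonpositive at every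
  \<open>m + n\<close>. Its deviation from the mean then sums to at least
  \<open>\<delta> \<Theta> A^2\<close> in absolute value, and cancelling
  \<open>\<Theta> \<delta> A\<close> from the bilinear bound contradicts the choice of
  \<open>A\<close>.\<close>

lemma primroot_below:
  assumes p: "prime p" "p > 2" and E: "finite E" "finite S" "E \<inter> S = {}"
    and ES: "E \<union> S = prime_factors (p - 1)"
    and \<delta>: "0 < \<delta>" "\<delta> = 1 - (\<Sum>q\<in>S. 1 / real q)"
    and A: "2 * A \<le> p" "sqrt (real p) * (2 ^ card E * (1 + real (card S) / \<delta>)) < real A"
  shows "\<exists>x>0. x < 2 * A \<and> residue_primroot p x"
proof (rule ccontr)
  assume none: "\<not> (\<exists>x>0. x < 2 * A \<and> residue_primroot p x)"
  have pr: "prime q" if "q \<in> E \<union> S" for q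
    using that by (simp add: ES in_prime_factors_iff)
  define \<Theta> where "\<Theta> = (\<Prod>q\<in>E. 1 - 1 / real q)"
  have \<Theta>: "\<Theta> > 0"
    unfolding \<Theta>_def
  proof (intro prod_pos)
    fix q assume "q \<in> E"
    then have "q > 1" using pr prime_gt_1_nat by blast
    then show "0 < 1 - 1 / real q" by simp
  qed
  define f :: "nat \<Rightarrow> real"
    where "f = (\<lambda>t. (\<Prod>q\<in>E. 1 - (if q dvd t then 1 else 0)) *
      (1 - (\<Sum>q\<in>S. if q dvd t then 1 else 0)))"
  have f_complex: "(\<Prod>q\<in>E. 1 - (if q dvd t then 1 else 0)) * (1 - (\<Sum>q\<in>S. if q dvd t then 1 else 0))
      = complex_of_real (f t)" for t
    by (simp add: f_def of_real_prod of_real_sum if_distrib cong: if_cong)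
  obtain W where W: "W \<le> \<Theta> * 2 ^ card E * (\<delta> + real (card S))"
    and osc: "oscillating (\<Prod>(E \<union> S)) W (\<lambda>t. complex_of_real (f t) - of_real (\<delta> * \<Theta>))"
    using oscillating_sieve[OF E pr] \<delta> unfolding \<Theta>_def f_complex by (metis less_imp_le)
  obtain ind where ind: "discrete_log p ind" using discrete_log_exists[OF p(1)] by blast
  have dvd: "\<Prod>(E \<union> S) dvd p - 1"
    using E pr by (intro prod_primes_dvd) (auto simp: ES in_prime_factors_iff)
  \<comment> \<open>Both sets have \<open>A\<close> elements, and the sums \<open>m + n\<close> lie
    in \<open>1..2 * A - 1\<close>, below \<open>p\<close>.\<close>
  define M where "M = {1..A}"
  define N where "N = {..<A}"
  have range: "m + n > 0" "m + n < 2 * A" "\<not> p dvd m + n" if "m \<in> M" "n \<in> N" for m n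
    using that A(1) by (auto simp: M_def N_def dest: dvd_imp_le)
  have A0: "real A > 0"
    using A(2) \<delta>(1) by (rule_tac le_less_trans[OF _ A(2)]) auto
  then have MN: "M \<subseteq> {..<p}" "N \<subseteq> {..<p}" using A(1) by (auto simp: M_def N_def)
  have f_le: "f (ind (m + n)) \<le> 0" if "m \<in> M" "n \<in> N" for m n
  proof -
    define t where "t = ind (m + n)"
    have "\<not> coprime t (p - 1)"
      using residue_primroot_if_coprime_discrete_log[OF p(1) ind] range[OF that] none
      by (auto simp: t_def)
    then have "gcd t (p - 1) \<noteq> 1" using coprime_iff_gcd_eq_1 by blast
    then obtain q where "prime q" "q dvd gcd t (p - 1)" using prime_factor_nat by blast
    then have q: "prime q" "q dvd t" "q dvd p - 1" by simp_all
    then have "q \<in> E \<union> S" using p(2) by (auto simp: ES in_prime_factors_iff)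
    \<comment> \<open>A core prime kills the product; a prime of \<open>S\<close> makes the second
      factor nonpositive while the product stays nonnegative.\<close>
    then have "f t \<le> 0"
    proof
      assume "q \<in> E"
      then have "(\<Prod>q\<in>E. 1 - (if q dvd t then 1 else 0)) = (0 :: real)"
        using q E by (intro prod_zero) auto
      then show ?thesis by (simp add: f_def)
    next
      assume "q \<in> S"
      then have "(1 :: real) \<le> (\<Sum>q\<in>S. if q dvd t then 1 else 0)"
        using member_le_sum[of q S "\<lambda>q. if q dvd t then 1 else 0 :: real"] E q by simp
      then show ?thesis unfolding f_def
        by (intro mult_nonneg_nonpos prod_nonneg) auto
    qed
    then show ?thesis by (simp add: t_def)
  qed
  have "\<delta> * \<Theta> * real A * real A \<le> - (\<Sum>m\<in>M. \<Sum>n\<in>N. f (ind (m + n)) - \<delta> * \<Theta>)"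
  proof -
    have "(\<Sum>m\<in>M. \<Sum>n\<in>N. f (ind (m + n)) - \<delta> * \<Theta>) \<le> (\<Sum>m\<in>M. \<Sum>n\<in>N. - (\<delta> * \<Theta>))"
      by (intro sum_mono) (use f_le in auto)
    then show ?thesis by (simp add: M_def N_def ac_simps)
  qed
  also have "\<dots> \<le> norm (complex_of_real (\<Sum>m\<in>M. \<Sum>n\<in>N. f (ind (m + n)) - \<delta> * \<Theta>))"
    by (simp only: norm_of_real)
  also have "\<dots> \<le> W * sqrt (real p * real (card M) * real (card N))"
    using oscillating_bilinear_bound[OF osc dvd p(1) ind MN range(3)] by simp
  also have "\<dots> = W * (sqrt (real p) * real A)"
    by (simp add: M_def N_def real_sqrt_mult)
  also have "\<dots> \<le> \<Theta> * 2 ^ card E * (\<delta> + real (card S)) * (sqrt (real p) * real A)"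
    using W by (intro mult_right_mono) auto
  also have "\<dots> = (\<Theta> * \<delta> * real A) * (sqrt (real p) * (2 ^ card E * (1 + real (card S) / \<delta>)))"
    using \<delta>(1) by (simp add: field_simps)
  also have "\<dots> < (\<Theta> * \<delta> * real A) * real A"
    using A(2) A0 \<delta>(1) \<Theta> by (intro mult_strict_left_mono) auto
  finally show False by (simp add: ac_simps)
qed

section \<open>Numerical estimates\<close>

text \<open>Every prime after the first is odd, so after the first step consecutive entries differ
  by at least 2.\<close>

lemma sorted_primes_nth_ge:
  assumes "sorted_wrt (<) qs" "\<And>q. q \<in> set qs \<Longrightarrow> prime q" "0 < i" "i < length qs"
  shows "2 * i + 1 \<le> qs ! i"
  using assms(3,4)
proof (induction i)
  case (Suc i)
  have pr: "prime (qs ! i)" "prime (qs ! Suc i)" using Suc.prems assms(2) by auto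
  have less: "qs ! i < qs ! Suc i"
    using Suc.prems sorted_wrt_nth_less[OF assms(1), of i "Suc i"] by simp
  have "2 * i + 1 < qs ! Suc i"
    using Suc less prime_gt_1_nat[OF pr(1)] by (cases "i = 0") auto
  moreover have "odd (qs ! Suc i)"
    using less prime_ge_2_nat[OF pr(1)] pr(2) by (intro prime_odd_nat) auto
  ultimately show ?case by presburger
qed simp

lemma prod_primes_ge:
  assumes "finite Q" "\<And>q. q \<in> Q \<Longrightarrow> prime q" "Q \<noteq> {}"
  shows "2 * (\<Prod>i\<in>{1..<card Q}. 2 * i + 1) \<le> \<Prod>Q"
proof -
  define qs where "qs = sorted_list_of_set Q"
  have qs: "sorted_wrt (<) qs" "set qs = Q" "length qs = card Q" "distinct qs"
    using assms(1) by (auto simp: qs_def)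
  have pos: "card Q > 0" using assms by (simp add: card_gt_0_iff)
  have "\<Prod>Q = (\<Prod>i<card Q. qs ! i)"
    using qs prod.list_conv_set_nth[of qs] prod.distinct_set_conv_list[of qs "\<lambda>x. x"]
    by (simp add: atLeast0LessThan)
  also have "{..<card Q} = insert 0 {1..<card Q}" using pos by auto
  finally have "\<Prod>Q = qs ! 0 * (\<Prod>i\<in>{1..<card Q}. qs ! i)" by simp
  moreover have "2 \<le> qs ! 0" using assms qs pos by (metis nth_mem prime_ge_2_nat)
  moreover have "(\<Prod>i\<in>{1..<card Q}. 2 * i + 1) \<le> (\<Prod>i\<in>{1..<card Q}. qs ! i)"
    using qs assms(2) by (intro prod_mono) (auto intro!: sorted_primes_nth_ge[simplified])
  ultimately show ?thesis by (simp add: mult_le_mono)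
qed

text \<open>The sum does not increase with \<open>k\<close>: a step drops
  \<open>1 / (2 k + 1)\<close> and adds four terms, each at most a quarter of it. The constant
  bounds the value at \<open>k = 6\<close>.\<close>

lemma sum_odd_reciprocals_le:
  assumes "k \<ge> 6"
  shows "(\<Sum>i\<in>{k..<4 * k + 3}. 1 / real (2 * i + 1)) \<le> 753 / 1000"
  using assms
proof (induction k rule: nat_induct_at_least)
  case base
  show ?case by (simp add: atLeastLessThan_nat_numeral)
next
  case (Suc k)
  have "(\<Sum>i\<in>{Suc k..<4 * Suc k + 3}. 1 / real (2 * i + 1)) =
      (\<Sum>i\<in>{Suc k..<4 * k + 3}. 1 / real (2 * i + 1)) + 1 / real (8 * k + 7)
        + 1 / real (8 * k + 9) + 1 / real (8 * k + 11) + 1 / real (8 * k + 13)"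
  proof -
    have "{Suc k..<4 * Suc k + 3} =
        {Suc k..<4 * k + 3} \<union> {4 * k + 3, 4 * k + 4, 4 * k + 5, 4 * k + 6}"
      by auto
    then show ?thesis by (simp only:) (simp add: algebra_simps)
  qed
  also have "\<dots> \<le> (\<Sum>i\<in>{Suc k..<4 * k + 3}. 1 / real (2 * i + 1)) + 1 / real (2 * k + 1)"
  proof -
    have "1 / real (8 * k + c) \<le> 1 / real (8 * k + 4)" if "c \<ge> 4" for c
      using that by (intro divide_left_mono) auto
    from this[of 7] this[of 9] this[of 11] this[of 13]
    have "1 / real (8 * k + 7) + 1 / real (8 * k + 9) + 1 / real (8 * k + 11) + 1 / real (8 * k + 13)
      \<le> 4 * (1 / real (8 * k + 4))" by simp
    also have "4 * (1 / real (8 * k + 4)) = 1 / real (2 * k + 1)" by (simp add: field_simps)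
    finally show ?thesis by simp
  qed
  also have "\<dots> = (\<Sum>i\<in>{k..<4 * k + 3}. 1 / real (2 * i + 1))"
    by (subst (2) sum.atLeast_Suc_lessThan) auto
  finally show ?case using Suc.IH by simp
qed

text \<open>The core takes the first \<open>k\<close> primes in increasing order. The others have
  index \<open>i \<ge> k > 0\<close>, so each is at least \<open>2 * i + 1\<close>.\<close>

lemma primes_split:
  assumes "finite Q" "\<And>q. q \<in> Q \<Longrightarrow> prime q" "card Q \<le> 4 * k + 3" "k \<ge> 6"
  obtains E S where "finite E" "finite S" "E \<inter> S = {}" "E \<union> S = Q"
    "card E \<le> k" "card S \<le> 3 * k + 3" "(\<Sum>q\<in>S. 1 / real q) \<le> 753 / 1000"
proof -
  define qs where "qs = sorted_list_of_set Q"
  have qs: "sorted_wrt (<) qs" "set qs = Q" "length qs = card Q" "distinct qs"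
    using assms(1) by (auto simp: qs_def)
  have "(\<Sum>q\<in>set (drop k qs). 1 / real q) = (\<Sum>i\<in>{k..<card Q}. 1 / real (qs ! i))"
  proof -
    have "set (drop k qs) = (\<lambda>i. qs ! i) ` {k..<card Q}"
    proof (intro subset_antisym subsetI)
      fix x assume "x \<in> set (drop k qs)"
      then obtain j where "j < card Q - k" "x = qs ! (k + j)"
        using qs by (auto simp: in_set_conv_nth)
      then show "x \<in> (\<lambda>i. qs ! i) ` {k..<card Q}" by auto
    next
      fix x assume "x \<in> (\<lambda>i. qs ! i) ` {k..<card Q}"
      then obtain i where "k \<le> i" "i < card Q" "x = qs ! i" by auto
      then show "x \<in> set (drop k qs)"
        using qs by (auto simp: in_set_conv_nth intro!: exI[of _ "i - k"])
    qed
    moreover have "inj_on (\<lambda>i. qs ! i) {k..<card Q}"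
      using qs by (auto simp: inj_on_def nth_eq_iff_index_eq)
    ultimately show ?thesis by (simp add: sum.reindex)
  qed
  also have "\<dots> \<le> (\<Sum>i\<in>{k..<card Q}. 1 / real (2 * i + 1))"
  proof (intro sum_mono)
    fix i assume i: "i \<in> {k..<card Q}"
    then have "2 * i + 1 \<le> qs ! i"
      using qs assms by (intro sorted_primes_nth_ge) auto
    then show "1 / real (qs ! i) \<le> 1 / real (2 * i + 1)"
      by (intro divide_left_mono) (auto simp del: of_nat_add of_nat_mult)
  qed
  also have "\<dots> \<le> (\<Sum>i\<in>{k..<4 * k + 3}. 1 / real (2 * i + 1))"
    using assms(3) by (intro sum_mono2) auto
  also have "\<dots> \<le> 753 / 1000" by (rule sum_odd_reciprocals_le[OF assms(4)])
  finally have sum: "(\<Sum>q\<in>set (drop k qs). 1 / real q) \<le> 753 / 1000" .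
  show ?thesis
  proof (rule that[of "set (take k qs)" "set (drop k qs)"])
    show "set (take k qs) \<inter> set (drop k qs) = {}"
      using qs by (intro set_take_disj_set_drop_if_distinct) auto
    show "set (take k qs) \<union> set (drop k qs) = Q"
      using qs(2) by (metis append_take_drop_id set_append)
    show "card (set (take k qs)) \<le> k"
      by (rule order.trans[OF card_length]) simp
    show "card (set (drop k qs)) \<le> 3 * k + 3"
      using assms(3) qs(3) by (intro order.trans[OF card_length]) simp
  qed (use sum in auto)
qed

text \<open>The factor of \<open>primroot_below\<close> when the core has \<open>k\<close> primes, at most \<open>3 * k + 3\<close> primes are
  sieved out, and \<open>\<delta>\<close> is at least \<open>1 - 753 / 1000\<close>.\<close>
definition sieve_factor :: "nat \<Rightarrow> real" where
  "sieve_factor k = 2 ^ k * (1 + real (3 * k + 3) / (247 / 1000))"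

text \<open>From \<open>k\<close> to \<open>k + 1\<close> the left side grows at most by
  \<open>3^8 = 9^4\<close>, while the right side gains four factors, each at least 9. The eighth
  power serves to bound \<open>2 * C + 1\<close> by \<open>p powr (1 / 8)\<close> later.\<close>

lemma sieve_factor_pow8_le:
  assumes "k \<ge> 7"
  shows "(2 * sieve_factor k + 1) ^ 8 \<le> real (2 * (\<Prod>i\<in>{1..<4 * k}. 2 * i + 1))"
  using assms
proof (induction k rule: nat_induct_at_least)
  case base
  have "(\<Prod>i\<in>{1..<4 * 7}. 2 * i + 1) = (8687364368561751199826958100282265625 :: nat)"
    by (simp add: atLeastLessThan_nat_numeral)
  then show ?case by (simp add: sieve_factor_def power_divide)
next
  case (Suc k)
  have pos: "sieve_factor k \<ge> 0" "sieve_factor (Suc k) \<ge> 0" by (auto simp: sieve_factor_def)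
  \<comment> \<open>The power of 2 doubles and the linear factor grows at most by
    \<open>3 / 2\<close>.\<close>
  have "2 * sieve_factor (Suc k) + 1 \<le> 3 * (2 * sieve_factor k + 1)"
  proof -
    have "2 * (1 + real (3 * Suc k + 3) / (247 / 1000)) \<le> 3 * (1 + real (3 * k + 3) / (247 / 1000))"
      using Suc.hyps by (simp add: field_simps)
    then have "2 ^ k * (2 * (1 + real (3 * Suc k + 3) / (247 / 1000)))
        \<le> 2 ^ k * (3 * (1 + real (3 * k + 3) / (247 / 1000)))"
      by (intro mult_left_mono) auto
    then have "sieve_factor (Suc k) \<le> 3 * sieve_factor k"
      unfolding sieve_factor_def power_Suc by (simp only: mult.assoc mult.left_commute)
    then show ?thesis by simp
  qed
  then have "(2 * sieve_factor (Suc k) + 1) ^ 8 \<le> (3 * (2 * sieve_factor k + 1)) ^ 8"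
    using pos by (intro power_mono) auto
  also have "\<dots> \<le> 9 ^ 4 * real (2 * (\<Prod>i\<in>{1..<4 * k}. 2 * i + 1))"
    unfolding power_mult_distrib using mult_left_mono[OF Suc.IH, of "3 ^ 8"] by simp
  also have "\<dots> = real (9 ^ 4 * (2 * (\<Prod>i\<in>{1..<4 * k}. 2 * i + 1)))" by simp
  also have "\<dots> \<le> real (2 * (\<Prod>i\<in>{1..<4 * Suc k}. 2 * i + 1))"
  proof -
    have "{1..<4 * Suc k} = {1..<4 * k} \<union> {4 * k, 4 * k + 1, 4 * k + 2, 4 * k + 3}"
      using Suc.hyps by auto
    then have "(\<Prod>i\<in>{1..<4 * Suc k}. 2 * i + 1) = (\<Prod>i\<in>{1..<4 * k}. 2 * i + 1) *
       ((8 * k + 1) * (8 * k + 3) * (8 * k + 5) * (8 * k + 7))"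
      by (simp only:) (simp add: algebra_simps)
    moreover have "9 * 9 * 9 * 9 \<le> (8 * k + 1) * (8 * k + 3) * (8 * k + 5) * (8 * k + 7)"
      using Suc.hyps by (intro mult_mono) auto
    ultimately show ?thesis by (simp only: of_nat_le_iff) (simp add: ac_simps)
  qed
  finally show ?case .
qed

section \<open>Choice of parameters and the resulting exponent\<close>

theorem theorem1:
  fixes p :: nat
  assumes "prime p" and "real p > 2.67 * 10 ^ 32"
  shows "real (least_primroot p) < real p powr 0.6309"
proof -
  define Q where "Q = prime_factors (p - 1)"
  \<comment> \<open>For \<open>k = 6\<close> the hypothesis on \<open>p\<close> beats the sieve factor; for larger \<open>k\<close> the size of
    \<open>\<Prod>Q\<close> does.\<close>
  define k where "k = max 6 (card Q div 4)"
  have p1: "real p > 1" using assms(2) by simp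
  have p2: "p > 2"
  proof -
    have "real p > 2" using assms(2) by simp
    then show ?thesis by simp
  qed
  have Q: "finite Q" "\<And>q. q \<in> Q \<Longrightarrow> prime q" "\<And>q. q \<in> Q \<Longrightarrow> q dvd p - 1"
    by (auto simp: Q_def in_prime_factors_iff)
  \<comment> \<open>The 3 accounts for the remainder of the division by 4.\<close>
  have Qk: "card Q \<le> 4 * k + 3" "k \<ge> 6" by (auto simp: k_def)
  define C where "C = sieve_factor k"
  have C: "C \<ge> 0" by (simp add: C_def sieve_factor_def)
  have C8: "(2 * C + 1) ^ 8 \<le> real p"
  proof (cases "k = 6")
    \<comment> \<open>Here \<open>(2 * C + 1) ^ 8\<close> is about \<open>2.16 * 10^32\<close>,
      below the assumed lower bound for \<open>p\<close>.\<close>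
    case True
    then have "(2 * C + 1) ^ 8 \<le> 2.67 * 10 ^ 32"
      by (simp add: C_def sieve_factor_def power_divide)
    then show ?thesis using assms(2) by simp
  next
    case False
    then have k: "k \<ge> 7" "4 * k \<le> card Q" by (auto simp: k_def)
    then have "Q \<noteq> {}" by auto
    have "(\<Prod>i\<in>{1..<4 * k}. 2 * i + 1) \<le> (\<Prod>i\<in>{1..<card Q}. 2 * i + 1 :: nat)"
      using k by (intro dvd_imp_le prod_dvd_prod_subset) (auto intro!: prod_pos)
    moreover have "2 * (\<Prod>i\<in>{1..<card Q}. 2 * i + 1) \<le> \<Prod>Q"
      by (rule prod_primes_ge[OF Q(1,2) \<open>Q \<noteq> {}\<close>])
    moreover have "\<Prod>Q \<le> p - 1"
      using p2 Q by (intro dvd_imp_le prod_primes_dvd) auto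
    ultimately have "2 * (\<Prod>i\<in>{1..<4 * k}. 2 * i + 1) \<le> p" by linarith
    then have "real (2 * (\<Prod>i\<in>{1..<4 * k}. 2 * i + 1)) \<le> real p" by (simp only: of_nat_le_iff)
    then show ?thesis using sieve_factor_pow8_le[OF k(1)] unfolding C_def by linarith
  qed
  obtain E S where ES: "finite E" "finite S" "E \<inter> S = {}" "E \<union> S = Q"
    "card E \<le> k" "card S \<le> 3 * k + 3" and sum: "(\<Sum>q\<in>S. 1 / real q) \<le> 753 / 1000"
    using primes_split[OF Q(1,2) Qk] by blast
  define \<delta> where "\<delta> = 1 - (\<Sum>q\<in>S. 1 / real q)"
  have \<delta>: "247 / 1000 \<le> \<delta>" using sum by (simp add: \<delta>_def)
  have le_C: "2 ^ card E * (1 + real (card S) / \<delta>) \<le> C"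
    unfolding C_def sieve_factor_def using \<delta> ES(5,6)
    by (intro mult_mono add_left_mono frac_le power_increasing) auto
  \<comment> \<open>The least integer strictly above \<open>sqrt p * C\<close>, as
    \<open>primroot_below\<close> asks for strict inequality.\<close>
  define A where "A = nat \<lfloor>sqrt (real p) * C\<rfloor> + 1"
  have "sqrt (real p) * C \<ge> 0" using C by simp
  then have A: "sqrt (real p) * C < real A" "real A \<le> sqrt (real p) * C + 1"
    unfolding A_def by linarith+
  \<comment> \<open>Rounding costs at most 1, absorbed by \<open>sqrt p \<ge> 1\<close>; hence
    \<open>2 * C + 1\<close> instead of \<open>2 * C\<close>. The \<open>- 1\<close> on the left
    reflects that a root below \<open>2 * A\<close> is at most \<open>2 * A - 1\<close>.\<close>
  have "real (2 * A) - 1 \<le> sqrt (real p) * (2 * C + 1)"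
  proof -
    have "sqrt (real p) \<ge> 1" using p1 by simp
    moreover have "sqrt (real p) * (2 * C + 1) = 2 * (sqrt (real p) * C) + sqrt (real p)"
      by (simp add: algebra_simps)
    moreover have "real (2 * A) = 2 * real A" by simp
    ultimately show ?thesis using A(2) by linarith
  qed
  also have "\<dots> \<le> real p powr (1 / 2) * real p powr (1 / 8)"
  proof (intro mult_mono)
    have "2 * C + 1 = ((2 * C + 1) powr 8) powr (1 / 8)"
      unfolding powr_powr using C by simp
    also have "\<dots> = ((2 * C + 1) ^ 8) powr (1 / 8)" using C by simp
    also have "\<dots> \<le> real p powr (1 / 8)" using C8 C by (intro powr_mono2) auto
    finally show "2 * C + 1 \<le> real p powr (1 / 8)" .
  qed (use C in \<open>auto simp: powr_half_sqrt\<close>)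
  also have "\<dots> = real p powr (5 / 8)" by (simp flip: powr_add)
  finally have A_le: "real (2 * A) - 1 \<le> real p powr (5 / 8)" .
  also have "\<dots> < real p powr 1" using p1 by (intro powr_less_mono) auto
  finally have "2 * A \<le> p" using p1 by simp
  moreover have "sqrt (real p) * (2 ^ card E * (1 + real (card S) / \<delta>)) < real A"
    using A(1) mult_left_mono[OF le_C, of "sqrt (real p)"] by simp
  ultimately obtain x where x: "x > 0" "x < 2 * A" "residue_primroot p x"
    using primroot_below[OF assms(1) p2 ES(1-3) _ _ \<delta>_def] ES(4) \<delta> unfolding Q_def by force
  have "least_primroot p \<le> x"
    unfolding least_primroot_def using x by (intro Least_le) auto
  then have "real (least_primroot p) \<le> real (2 * A) - 1" using x(2) by linarith
  also have "\<dots> \<le> real p powr (5 / 8)" by fact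
  \<comment> \<open>Strict because \<open>5 / 8 = 0.625\<close> is below the stated
    exponent.\<close>
  also have "\<dots> < real p powr 0.6309" using p1 by (intro powr_less_mono) auto
  finally show ?thesis .
qed

end
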